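(* Let $c>0$ and let $g^c$ be the one-loop deformed universal hypermultiplet metric on $M=\mathbb{R}_{>0}\times\mathbb{R}^3$ (defined in the context). The pinching function $p\mapsto\delta_p$ of $(M,g^c)$, $$\delta_p := \frac{\max\{K(\Pi)\mid \Pi\subset T_pM\}}{\min\{K(\Pi)\mid \Pi\subset T_pM\}},$$ satisfies $\frac14<\delta_p<1$ for all $p\in M$, and it attains the boundary values asymptotically: with $\tilde\rho=\rho/c$, $\delta_p\to 1$ as $\tilde\rho\to 0$ and $\delta_p\to\frac14$ as $\tilde\rho\to\infty$. That is, $M$ is everywhere (at least) quarter-pinched.
   Context: On $M=\mathbb{R}_{>0}\times\mathbb{R}^3$ with coordinates $(\rho,\tilde\phi,\zeta^0,\tilde\zeta_0)$, $\rho>0$, the metric $g^c$ ($c\ge 0$) is $$g^c=\frac{1}{4\rho^2}\left[\frac{\rho+2c}{\rho+c}\,d\rho^2+\frac{\rho+c}{\rho+2c}\,(d\tilde\phi+\zeta^0 d\tilde\zeta_0-\tilde\zeta_0 d\zeta^0)^2+2(\rho+2c)\left((d\tilde\zeta_0)^2+(d\zeta^0)^2\right)\right].$$ $K(\Pi)$ denotes the sectional curvature of $g^c$ on a $2$-plane $\Pi\subset T_pM$; the maximum and minimum are over all $2$-planes in $T_pM$. *)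

theory Defs
  imports "HOL-Analysis.Analysis"
begin

section \<open>Curvature of a metric on an open subset of coordinate space\<close>

text \<open>
  A metric is a map \<open>g\<close> taking a point and two tangent vectors to a real number; tangent vectors
  are identified with their components in the coordinate frame.
\<close>

type_synonym 'n metric = "real ^ 'n \<Rightarrow> real ^ 'n \<Rightarrow> real ^ 'n \<Rightarrow> real"

definition partial_deriv :: "'n::finite \<Rightarrow> (real ^ 'n \<Rightarrow> real) \<Rightarrow> real ^ 'n \<Rightarrow> real" where
  "partial_deriv i f p = deriv (\<lambda>t. f (p + t *\<^sub>R axis i 1)) 0"

definition metric_matrix :: "'n::finite metric \<Rightarrow> real ^ 'n \<Rightarrow> real ^ 'n ^ 'n" where
  "metric_matrix g p = (\<chi> i j. g p (axis i 1) (axis j 1))"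

text \<open>\<open>christoffel g k i j p\<close> has upper index \<open>k\<close> and lower indices \<open>i\<close>, \<open>j\<close>.\<close>

definition christoffel :: "'n::finite metric \<Rightarrow> 'n \<Rightarrow> 'n \<Rightarrow> 'n \<Rightarrow> real ^ 'n \<Rightarrow> real" where
  "christoffel g k i j p =
     (1 / 2) * (\<Sum>l\<in>UNIV. matrix_inv (metric_matrix g p) $ k $ l *
        (partial_deriv i (\<lambda>x. metric_matrix g x $ j $ l) p
       + partial_deriv j (\<lambda>x. metric_matrix g x $ i $ l) p
       - partial_deriv l (\<lambda>x. metric_matrix g x $ i $ j) p))"

text \<open>
  \<open>riemann_coeff g l k i j\<close> is the \<open>l\<close>-th component of \<open>R(\<partial>\<^sub>i, \<partial>\<^sub>j) \<partial>\<^sub>k\<close>, with the convention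
  \<open>R(X, Y) Z = \<nabla>\<^sub>X \<nabla>\<^sub>Y Z - \<nabla>\<^sub>Y \<nabla>\<^sub>X Z - \<nabla>\<^bsub>[X, Y]\<^esub> Z\<close>.
\<close>

definition riemann_coeff ::
    "'n::finite metric \<Rightarrow> 'n \<Rightarrow> 'n \<Rightarrow> 'n \<Rightarrow> 'n \<Rightarrow> real ^ 'n \<Rightarrow> real" where
  "riemann_coeff g l k i j p =
     partial_deriv i (christoffel g l j k) p - partial_deriv j (christoffel g l i k) p
     + (\<Sum>m\<in>UNIV. christoffel g l i m p * christoffel g m j k p
                 - christoffel g l j m p * christoffel g m i k p)"

definition riemann ::
    "'n::finite metric \<Rightarrow> real ^ 'n \<Rightarrow> real ^ 'n \<Rightarrow> real ^ 'n \<Rightarrow> real ^ 'n \<Rightarrow> real ^ 'n" where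
  "riemann g p u v w =
     (\<chi> l. \<Sum>i\<in>UNIV. \<Sum>j\<in>UNIV. \<Sum>k\<in>UNIV. riemann_coeff g l k i j p * u $ i * v $ j * w $ k)"

definition sectional_of_basis ::
    "'n::finite metric \<Rightarrow> real ^ 'n \<Rightarrow> real ^ 'n \<Rightarrow> real ^ 'n \<Rightarrow> real" where
  "sectional_of_basis g p u v =
     g p (riemann g p u v v) u / (g p u u * g p v v - (g p u v)\<^sup>2)"

definition planes :: "(real ^ 'n::finite) set set" where
  "planes = {P. subspace P \<and> dim P = 2}"

text \<open>
  For a plane \<open>P\<close>, the pairs spanning \<open>P\<close> are exactly its bases, so this is the common value
  over all bases of \<open>P\<close>.
\<close>

definition sectional_curvature ::
    "'n::finite metric \<Rightarrow> real ^ 'n \<Rightarrow> (real ^ 'n) set \<Rightarrow> real" where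
  "sectional_curvature g p P =
     (THE k. \<forall>u v. span {u, v} = P \<longrightarrow> sectional_of_basis g p u v = k)"

definition pinching :: "'n::finite metric \<Rightarrow> real ^ 'n \<Rightarrow> real" where
  "pinching g p =
     (GREATEST k. k \<in> sectional_curvature g p ` planes) /
     (LEAST k. k \<in> sectional_curvature g p ` planes)"


section \<open>The one-loop deformed universal hypermultiplet metric\<close>

text \<open>
  The coordinates \<open>(\<rho>, \<phi>, \<zeta>\<^sup>0, \<zeta>\<^sub>0)\<close> (tildes omitted on the second and fourth) are the components
  1, 2, 3, 4. The index type \<open>4\<close> is cyclic, so the numeral 4 in it denotes the
  fourth index, which is distinct from 1, 2 and 3.
\<close>

definition hyper_M :: "(real ^ 4) set" where
  "hyper_M = {p. p $ 1 > 0}"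

text \<open>The one-form \<open>d\<phi> + \<zeta>\<^sup>0 d\<zeta>\<^sub>0 - \<zeta>\<^sub>0 d\<zeta>\<^sup>0\<close>.\<close>

definition hyper_form :: "real ^ 4 \<Rightarrow> real ^ 4 \<Rightarrow> real" where
  "hyper_form p v = v $ 2 + p $ 3 * v $ 4 - p $ 4 * v $ 3"

definition hyper_metric :: "real \<Rightarrow> 4 metric" where
  "hyper_metric c p v w =
     (let \<rho> = p $ 1 in
      1 / (4 * \<rho>\<^sup>2) *
        ((\<rho> + 2 * c) / (\<rho> + c) * (v $ 1 * w $ 1)
       + (\<rho> + c) / (\<rho> + 2 * c) * (hyper_form p v * hyper_form p w)
       + 2 * (\<rho> + 2 * c) * (v $ 4 * w $ 4 + v $ 3 * w $ 3)))"

end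

theory Submission
  imports Defs "HOL-Real_Asymp.Real_Asymp"
begin

text \<open>
  Write \<open>r\<close>, \<open>x\<close>, \<open>y\<close> for the first, third and fourth coordinate and \<open>\<eta>\<close> for the one-form
  \<^const>\<open>hyper_form\<close>, so that \<open>d\<eta> = 2 dx \<and> dy\<close>. The metric has the shape
  \<open>E dr\<^sup>2 + N \<eta>\<^sup>2 + H (dx\<^sup>2 + dy\<^sup>2)\<close> with coefficients that depend on \<open>r\<close> only. In the
  coframe \<open>dr, \<eta>, dx, dy\<close> the connection and the curvature of such a metric depend on \<open>r\<close> only.

  The pinching estimate rests on one identity. Put \<open>t = (r / (r + 2c))\<^sup>3\<close> and
  \<open>\<omega> = dr \<and> \<eta> / (4r\<^sup>2) - H dx \<and> dy\<close>, up to signs the sum of the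
  unit area forms of two orthogonal planes.
  Then
    \<open>g(R(u,v)v, u) = (t - 2) Gram(u,v) - 3 t \<omega>(u,v)\<^sup>2\<close>
  (\<open>hyper_curvature\<close>), the curvature of a metric that interpolates between constant curvature
  \<open>-2\<close> at \<open>t = 0\<close> and the complex hyperbolic plane at \<open>t = 1\<close>. Hence a plane has sectional
  curvature \<open>t - 2 - 3 t s\<close>, where \<open>s = \<omega>\<^sup>2 / Gram\<close> measures how close the plane is to a complex line. Always
  \<open>0 \<le> s \<le> 1\<close> (\<open>hyper_omega_le_gram\<close>), and both ends occur: \<open>s = 1\<close> for the plane of \<open>\<partial>\<^sub>r\<close> and
  \<open>\<partial>\<^sub>\<phi>\<close>, and \<open>s = 0\<close> for the plane of \<open>\<partial>\<^sub>r\<close> and a vector in the kernels of \<open>dr\<close>, \<open>\<eta>\<close>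
  and \<open>dy\<close>. The extreme curvatures are therefore \<open>t - 2\<close> and \<open>-2 - 2t\<close>, both negative, and
    \<open>\<delta> = (2 - t) / (2 + 2t)\<close>
  (\<open>pinching_hyper\<close>). This decreases from \<open>1\<close> to \<open>1/4\<close> as \<open>t\<close> runs through the interval from
  \<open>0\<close> to \<open>1\<close>, that is, as \<open>r / c\<close> runs from \<open>0\<close> to infinity.

  The curvature identity is reached without tabulating Christoffel symbols. The connection is
  found as a bilinear map from the geodesic equations, identified by the Koszul formula
  (\<open>christoffel_koszul\<close>), and differentiated as a bilinear map (\<open>riemann_connection_form\<close>); what
  remains are polynomial identities in the components of \<open>u\<close> and \<open>v\<close> and rational identities in
  \<open>r\<close> and \<open>c\<close>.
\<close>

section \<open>Connection and curvature without indices\<close>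

lemma linear_axis_expansion:
  fixes f :: "real ^ 'n::finite \<Rightarrow> 'b::real_vector"
  assumes "linear f"
  shows "f v = (\<Sum>i\<in>UNIV. v $ i *\<^sub>R f (axis i 1))"
proof -
  have "f v = f (\<Sum>i\<in>UNIV. v $ i *\<^sub>R axis i 1)"
    using basis_expansion[of v] by (simp add: scalar_mult_eq_scaleR)
  also have "\<dots> = (\<Sum>i\<in>UNIV. v $ i *\<^sub>R f (axis i 1))"
    by (simp add: linear_sum[OF assms] linear_scale[OF assms])
  finally show ?thesis .
qed

text \<open>
  The Koszul formula determines the covariant derivative of the frame field \<open>j\<close> in direction \<open>i\<close>,
  so a vector \<open>C\<close> that satisfies it has the Christoffel symbols as components. Nondegeneracy
  is what allows cancelling the metric matrix; the entries of its inverse never have to be known.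
\<close>

lemma christoffel_koszul:
  fixes g :: "'n::finite metric"
  assumes lin: "\<And>u. linear (g p u)"
    and sym: "\<And>u v. g p u v = g p v u"
    and pos: "\<And>v. v \<noteq> 0 \<Longrightarrow> g p v v > 0"
    and koszul: "\<And>l. partial_deriv i (\<lambda>x. metric_matrix g x $ j $ l) p
                   + partial_deriv j (\<lambda>x. metric_matrix g x $ i $ l) p
                   - partial_deriv l (\<lambda>x. metric_matrix g x $ i $ j) p = 2 * g p C (axis l 1)"
  shows "christoffel g k i j p = C $ k"
proof -
  let ?G = "metric_matrix g p"
  have mult: "(?G *v v) $ l = g p (axis l 1) v" for v l
    by (simp add: matrix_vector_mult_def metric_matrix_def
        linear_axis_expansion[OF lin, of "axis l 1" v] mult.commute)
  have "v = 0" if "?G *v v = 0" for v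
  proof -
    have "g p v v = (\<Sum>l\<in>UNIV. v $ l * g p v (axis l 1))"
      using linear_axis_expansion[OF lin, of v v] by simp
    also have "\<dots> = (\<Sum>l\<in>UNIV. v $ l * (?G *v v) $ l)"
      by (simp add: mult sym)
    also have "\<dots> = 0" by (simp add: that)
    finally show ?thesis using pos[of v] by force
  qed
  then have inv: "invertible ?G"
    by (simp add: invertible_left_inverse matrix_left_invertible_ker)
  have left: "matrix_inv ?G ** ?G = mat 1"
    using someI_ex[OF inv[unfolded invertible_def]] by (simp add: matrix_inv_def)
  have "christoffel g k i j p = (\<Sum>l\<in>UNIV. matrix_inv ?G $ k $ l * (?G *v C) $ l)"
    by (simp add: christoffel_def koszul mult sym sum_distrib_left)
  also have "\<dots> = (matrix_inv ?G *v (?G *v C)) $ k"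
    by (simp add: matrix_vector_mult_def[of "matrix_inv ?G"])
  also have "\<dots> = C $ k"
    by (simp add: matrix_vector_mul_assoc left)
  finally show ?thesis .
qed

lemma partial_deriv_cong_open:
  assumes "open S" "p \<in> S" and eq: "\<And>x. x \<in> S \<Longrightarrow> f x = h x"
  shows "partial_deriv i f p = partial_deriv i h p"
proof -
  have "((\<lambda>t::real. p + t *\<^sub>R axis i 1) \<longlongrightarrow> p + 0 *\<^sub>R axis i 1) (nhds 0)"
    by (intro tendsto_add tendsto_scaleR tendsto_const filterlim_ident)
  then have "eventually (\<lambda>t::real. p + t *\<^sub>R axis i 1 \<in> S) (nhds 0)"
    using topological_tendstoD[of _ p "nhds 0" S] assms by simp
  then have "eventually (\<lambda>t. f (p + t *\<^sub>R axis i 1) = h (p + t *\<^sub>R axis i 1)) (nhds 0)"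
    by eventually_elim (rule eq)
  then show ?thesis
    unfolding partial_deriv_def by (intro deriv_cong_ev) auto
qed

text \<open>
  Both sides are trilinear, and they agree on the coordinate frame by the definition of the
  curvature coefficients. In this form the curvature of an explicit connection is obtained from one
  directional derivative and two compositions, for all \<open>n\<^sup>4\<close> index combinations at once.
\<close>

lemma riemann_connection_form:
  fixes g :: "'n::finite metric" and \<Gamma> :: "real ^ 'n \<Rightarrow> real ^ 'n \<Rightarrow> real ^ 'n \<Rightarrow> real ^ 'n"
  assumes S: "open S" "p \<in> S"
    and chr: "\<And>x i j k. x \<in> S \<Longrightarrow> christoffel g k i j x = \<Gamma> x (axis i 1) (axis j 1) $ k"
    and lin: "\<And>u. linear (\<Gamma> p u)" "\<And>v. linear (\<lambda>u. \<Gamma> p u v)"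
    and der: "\<And>i u v l. ((\<lambda>t. \<Gamma> (p + t *\<^sub>R axis i 1) u v $ l)
                 has_real_derivative D (axis i 1) u v $ l) (at 0)"
    and linD: "\<And>u v. linear (\<lambda>w. D w u v)" "\<And>w v. linear (\<lambda>u. D w u v)" "\<And>w u. linear (D w u)"
  shows "riemann g p u v w = D u v w - D v u w + \<Gamma> p u (\<Gamma> p v w) - \<Gamma> p v (\<Gamma> p u w)"
proof -
  define T where "T u v w = D u v w - D v u w + \<Gamma> p u (\<Gamma> p v w) - \<Gamma> p v (\<Gamma> p u w)" for u v w
  have pd: "partial_deriv i (christoffel g l j k) p = D (axis i 1) (axis j 1) (axis k 1) $ l" for i j k l
  proof -
    have "partial_deriv i (christoffel g l j k) p = partial_deriv i (\<lambda>x. \<Gamma> x (axis j 1) (axis k 1) $ l) p"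
      by (rule partial_deriv_cong_open[OF S chr])
    also have "\<dots> = D (axis i 1) (axis j 1) (axis k 1) $ l"
      unfolding partial_deriv_def by (rule DERIV_imp_deriv[OF der])
    finally show ?thesis .
  qed
  \<comment> \<open>The quadratic terms of the curvature coefficients are compositions of the connection with itself.\<close>
  have quad: "(\<Sum>m\<in>UNIV. \<Gamma> p a (axis m 1) $ l * z $ m) = \<Gamma> p a z $ l" for a z l
    using arg_cong[OF linear_axis_expansion[OF lin(1), of a z], of "\<lambda>z. z $ l"]
    by (simp add: mult.commute)
  have coeff: "riemann_coeff g l k i j p = T (axis i 1) (axis j 1) (axis k 1) $ l" for l k i j
    by (simp add: riemann_coeff_def pd chr[OF S(2)] T_def sum_subtractf quad)
  have T1: "linear (\<lambda>u. T u v w)" for v w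
    unfolding T_def
    by (intro linear_compose_sub linear_compose_add linD lin
        linear_compose[OF lin(2) lin(1), unfolded o_def])
  have T2: "linear (\<lambda>v. T u v w)" for u w
    unfolding T_def
    by (intro linear_compose_sub linear_compose_add linD lin
        linear_compose[OF lin(2) lin(1), unfolded o_def])
  have T3: "linear (\<lambda>w. T u v w)" for u v
    unfolding T_def
    by (intro linear_compose_sub linear_compose_add linD lin
        linear_compose[OF lin(1) lin(1), unfolded o_def])
  have "T u v w $ l = riemann g p u v w $ l" for l
  proof -
    have "T u v w = (\<Sum>i\<in>UNIV. u $ i *\<^sub>R (\<Sum>j\<in>UNIV. v $ j *\<^sub>R
             (\<Sum>k\<in>UNIV. w $ k *\<^sub>R T (axis i 1) (axis j 1) (axis k 1))))"
      by (subst linear_axis_expansion[OF T1], subst linear_axis_expansion[OF T2],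
          subst linear_axis_expansion[OF T3]) simp
    then show ?thesis
      by (simp add: riemann_def coeff sum_distrib_left mult_ac)
  qed
  then show ?thesis by (simp add: vec_eq_iff T_def)
qed

lemma hyper_form_linear: "linear (hyper_form p)"
  by (intro linearI) (simp_all add: hyper_form_def algebra_simps)

section \<open>Planes and Gram determinants\<close>

definition gram :: "('a \<Rightarrow> 'a \<Rightarrow> real) \<Rightarrow> 'a \<Rightarrow> 'a \<Rightarrow> real" where
  "gram B u v = B u u * B v v - (B u v)\<^sup>2"

text \<open>
  The Gram determinant is the squared area of the parallelogram, so it scales with the square of
  the determinant of a change of basis. This is half of the reason why the sectional curvature
  depends on the plane only.
\<close>

lemma gram_change_of_basis:
  fixes B :: "'a::real_vector \<Rightarrow> 'a \<Rightarrow> real"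
  assumes lin: "\<And>u. linear (B u)" and sym: "\<And>u v. B u v = B v u"
  shows "gram B (a *\<^sub>R u + b *\<^sub>R v) (c *\<^sub>R u + d *\<^sub>R v) = (a * d - b * c)\<^sup>2 * gram B u v"
proof -
  have r: "B x (a *\<^sub>R u + b *\<^sub>R v) = a * B x u + b * B x v" for x a b
    by (simp add: linear_add[OF lin] linear_scale[OF lin])
  have l: "B (a *\<^sub>R u + b *\<^sub>R v) x = a * B u x + b * B v x" for x a b
    using r[of x a b] by (simp add: sym)
  show ?thesis
    unfolding gram_def r l sym[of v u] by algebra
qed

text \<open>
  The vector \<open>w = B(v,v) u - B(u,v) v\<close> is orthogonal to \<open>v\<close> and has square length
  \<open>B(v,v)\<close> times the Gram determinant, so the determinant vanishes exactly when \<open>u\<close> is a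
  multiple of \<open>v\<close>.
\<close>

lemma span_pair_plane_iff:
  fixes B :: "real ^ 'n::finite \<Rightarrow> real ^ 'n \<Rightarrow> real"
  assumes lin: "\<And>u. linear (B u)" and sym: "\<And>u v. B u v = B v u"
    and pos: "\<And>v. v \<noteq> 0 \<Longrightarrow> B v v > 0"
  shows "span {u, v} \<in> planes \<longleftrightarrow> gram B u v > 0"
proof -
  have zero: "B x 0 = 0" "B 0 x = 0" for x
    using linear_0[OF lin] sym by metis+
  have dim: "span {u, v} \<in> planes \<longleftrightarrow> v \<noteq> 0 \<and> u \<notin> span {v}"
    by (auto simp: planes_def dim_insert)
  show ?thesis
  proof (cases "v = 0")
    case True
    then show ?thesis using dim by (simp add: gram_def zero)
  next
    case False
    define w where "w = B v v *\<^sub>R u + (- B u v) *\<^sub>R v"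
    have "gram B w v = (B v v)\<^sup>2 * gram B u v"
      using gram_change_of_basis[OF lin sym, of "B v v" u "- B u v" v 0 1] by (simp add: w_def)
    moreover have "B w v = 0"
      unfolding sym[of w v]
      by (simp add: w_def linear_add[OF lin] linear_diff[OF lin] linear_scale[OF lin] sym[of v u])
    ultimately have w: "B w w = B v v * gram B u v"
      using pos[OF False] by (simp add: gram_def power2_eq_square)
    have "u \<in> span {v} \<longleftrightarrow> w = 0"
    proof
      assume "u \<in> span {v}"
      then obtain k where "u = k *\<^sub>R v" by (auto simp: span_singleton)
      then show "w = 0"
        using sym[of u v] by (simp add: w_def linear_scale[OF lin])
    next
      assume "w = 0"
      then have "B v v *\<^sub>R u = B u v *\<^sub>R v" by (simp add: w_def)
      then have "(1 / B v v) *\<^sub>R (B v v *\<^sub>R u) = (1 / B v v) *\<^sub>R (B u v *\<^sub>R v)"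
        by (rule arg_cong)
      then have "u = (B u v / B v v) *\<^sub>R v"
        using pos[OF False] by simp
      then show "u \<in> span {v}" unfolding span_singleton by blast
    qed
    moreover have "w = 0 \<longleftrightarrow> \<not> gram B u v > 0"
      using w pos[OF False] pos[of w] zero by (auto simp: zero_less_mult_iff)
    ultimately show ?thesis using dim False by blast
  qed
qed

lemma span_pair_combination:
  assumes "x \<in> span {u, v :: 'a::real_vector}"
  obtains a b where "x = a *\<^sub>R u + b *\<^sub>R v"
proof -
  obtain a where "x - a *\<^sub>R u \<in> span {v}" using assms by (auto simp: span_insert)
  then obtain b where "x - a *\<^sub>R u = b *\<^sub>R v" by (auto simp: span_singleton)
  then show thesis using that[of a b] by (simp add: diff_eq_eq add.commute)
qed

lemma plane_obtains_basis:
  assumes "P \<in> planes"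
  obtains u v where "P = span {u, v}"
proof -
  obtain B where B: "B \<subseteq> P" "independent B" "P \<subseteq> span B" "card B = dim P"
    using basis_exists by blast
  then have "card B = 2" "subspace P" using assms by (auto simp: planes_def)
  then obtain u v where "B = {u, v}" by (auto simp: card_2_iff)
  with B \<open>subspace P\<close> have "P = span {u, v}" using span_subspace[of B P] by simp
  then show thesis by (rule that)
qed

section \<open>Coordinates and coefficient functions\<close>

definition vec4 :: "real \<Rightarrow> real \<Rightarrow> real \<Rightarrow> real \<Rightarrow> real ^ 4" where
  "vec4 a b c d = (\<chi> i. if i = 1 then a else if i = 2 then b else if i = 3 then c else d)"

lemma vec4_nth [simp]:
  "vec4 a b c d $ 1 = a" "vec4 a b c d $ 2 = b" "vec4 a b c d $ 3 = c" "vec4 a b c d $ 4 = d"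
  by (simp_all add: vec4_def)

lemma vec4_eqI:
  fixes x y :: "real ^ 4"
  assumes "x $ 1 = y $ 1" "x $ 2 = y $ 2" "x $ 3 = y $ 3" "x $ 4 = y $ 4"
  shows "x = y"
  using assms by (simp add: vec_eq_iff forall_4)

lemma linear_mult_const:
  fixes f :: "'a::real_vector \<Rightarrow> real"
  assumes "linear f"
  shows "linear (\<lambda>x. k * f x)" "linear (\<lambda>x. f x * k)"
  using assms by (auto simp: linear_iff algebra_simps)

lemma linear_nth: "linear (\<lambda>x :: real ^ 'n. x $ i)"
  by (simp add: linear_iff)

lemma linear_vec4:
  assumes "linear f1" "linear f2" "linear f3" "linear f4"
  shows "linear (\<lambda>x. vec4 (f1 x) (f2 x) (f3 x) (f4 x))"
  using assms by (auto simp: linear_iff intro!: vec4_eqI)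

text \<open>The two-form \<open>dx \<and> dy\<close>, half the exterior derivative of \<open>\<eta>\<close>.\<close>

definition base_area :: "real ^ 4 \<Rightarrow> real ^ 4 \<Rightarrow> real" where
  "base_area u v = u $ 3 * v $ 4 - u $ 4 * v $ 3"

text \<open>
  The coefficients of \<open>\<eta>\<close> are linear in the point, and their derivative is half of \<open>d\<eta>\<close>. All
  dependence of the curvature on the twisting of \<open>\<eta>\<close> enters through this rule.
\<close>

lemma hyper_form_has_derivative:
  "((\<lambda>t. hyper_form (p + t *\<^sub>R w) u) has_real_derivative base_area w u) (at t)"
  unfolding hyper_form_def base_area_def
  by (auto intro!: derivative_eq_intros simp: algebra_simps)

lemma base_area_linear: "linear (base_area u)" "linear (\<lambda>u. base_area u v)"
  by (intro linearI; simp add: base_area_def algebra_simps)+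

text \<open>
  With the metric written as \<open>E dr\<^sup>2 + N \<eta>\<^sup>2 + H (dx\<^sup>2 + dy\<^sup>2)\<close>, the following are \<open>E'/(2E)\<close>,
  \<open>N'/(2N)\<close>, \<open>H'/(2H)\<close>, then \<open>H\<close>, \<open>N/H\<close>, \<open>H/E\<close> and \<open>E/H\<close>. In these quantities and the
  derivatives of the first three, the connection and its derivative are polynomial, because each derivative of a ratio is the ratio
  times a difference of logarithmic derivatives. No division then enters the tensor identities
  below: the relation \<open>(H/E) (E/H) = 1\<close> takes its place.
\<close>

definition log_deriv_E :: "real \<Rightarrow> real \<Rightarrow> real" where
  "log_deriv_E c r = (1 / (r + 2 * c) - 1 / (r + c)) / 2 - 1 / r"

definition log_deriv_N :: "real \<Rightarrow> real \<Rightarrow> real" where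
  "log_deriv_N c r = (1 / (r + c) - 1 / (r + 2 * c)) / 2 - 1 / r"

definition log_deriv_H :: "real \<Rightarrow> real \<Rightarrow> real" where
  "log_deriv_H c r = 1 / (r + 2 * c) / 2 - 1 / r"

definition coeff_H :: "real \<Rightarrow> real \<Rightarrow> real" where
  "coeff_H c r = (r + 2 * c) / (2 * r\<^sup>2)"

definition ratio_NH :: "real \<Rightarrow> real \<Rightarrow> real" where
  "ratio_NH c r = (r + c) / (2 * (r + 2 * c)\<^sup>2)"

definition ratio_HE :: "real \<Rightarrow> real \<Rightarrow> real" where
  "ratio_HE c r = 2 * (r + c)"

definition ratio_EH :: "real \<Rightarrow> real \<Rightarrow> real" where
  "ratio_EH c r = 1 / (2 * (r + c))"

lemma ratio_HE_EH: "c > 0 \<Longrightarrow> r > 0 \<Longrightarrow> ratio_HE c r * ratio_EH c r = 1"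
  by (simp add: ratio_HE_def ratio_EH_def)

lemma coeff_H_deriv:
  assumes "c > 0" "r > 0"
  shows "(coeff_H c has_real_derivative 2 * log_deriv_H c r * coeff_H c r) (at r)"
proof -
  have "r + c \<noteq> 0" "r + 2 * c \<noteq> 0" "r \<noteq> 0" using assms by auto
  then show ?thesis
    unfolding coeff_H_def log_deriv_H_def
    by (auto intro!: derivative_eq_intros simp: divide_simps power2_eq_square) (simp add: algebra_simps)?
qed

lemma ratio_NH_deriv:
  assumes "c > 0" "r > 0"
  shows "(ratio_NH c has_real_derivative 2 * (log_deriv_N c r - log_deriv_H c r) * ratio_NH c r) (at r)"
proof -
  have "r + c \<noteq> 0" "r + 2 * c \<noteq> 0" "r \<noteq> 0" using assms by auto
  then show ?thesis
    unfolding ratio_NH_def log_deriv_H_def log_deriv_N_def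
    by (auto intro!: derivative_eq_intros simp: divide_simps power2_eq_square) (simp add: algebra_simps)?
qed

lemma ratio_HE_deriv:
  assumes "c > 0" "r > 0"
  shows "(ratio_HE c has_real_derivative 2 * (log_deriv_H c r - log_deriv_E c r) * ratio_HE c r) (at r)"
proof -
  have "r + c \<noteq> 0" "r + 2 * c \<noteq> 0" "r \<noteq> 0" using assms by auto
  then show ?thesis
    unfolding ratio_HE_def log_deriv_H_def log_deriv_E_def
    by (auto intro!: derivative_eq_intros simp: divide_simps power2_eq_square) (simp add: algebra_simps)?
qed

lemma ratio_EH_deriv:
  assumes "c > 0" "r > 0"
  shows "(ratio_EH c has_real_derivative 2 * (log_deriv_E c r - log_deriv_H c r) * ratio_EH c r) (at r)"
proof -
  have "r + c \<noteq> 0" "r + 2 * c \<noteq> 0" "r \<noteq> 0" using assms by auto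
  then show ?thesis
    unfolding ratio_EH_def log_deriv_H_def log_deriv_E_def
    by (auto intro!: derivative_eq_intros simp: divide_simps power2_eq_square) (simp add: algebra_simps)?
qed

definition log_deriv2_E :: "real \<Rightarrow> real \<Rightarrow> real" where
  "log_deriv2_E c r = (1 / (r + c)\<^sup>2 - 1 / (r + 2 * c)\<^sup>2) / 2 + 1 / r\<^sup>2"

lemma log_deriv_E_deriv:
  assumes "c > 0" "r > 0"
  shows "(log_deriv_E c has_real_derivative log_deriv2_E c r) (at r)"
proof -
  have "r + c \<noteq> 0" "r + 2 * c \<noteq> 0" "r \<noteq> 0" using assms by auto
  then show ?thesis
    unfolding log_deriv_E_def log_deriv2_E_def
    by (auto intro!: derivative_eq_intros simp: power2_eq_square)
qed

definition log_deriv2_N :: "real \<Rightarrow> real \<Rightarrow> real" where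
  "log_deriv2_N c r = (1 / (r + 2 * c)\<^sup>2 - 1 / (r + c)\<^sup>2) / 2 + 1 / r\<^sup>2"

lemma log_deriv_N_deriv:
  assumes "c > 0" "r > 0"
  shows "(log_deriv_N c has_real_derivative log_deriv2_N c r) (at r)"
proof -
  have "r + c \<noteq> 0" "r + 2 * c \<noteq> 0" "r \<noteq> 0" using assms by auto
  then show ?thesis
    unfolding log_deriv_N_def log_deriv2_N_def
    by (auto intro!: derivative_eq_intros simp: power2_eq_square)
qed

definition log_deriv2_H :: "real \<Rightarrow> real \<Rightarrow> real" where
  "log_deriv2_H c r = 1 / r\<^sup>2 - 1 / (r + 2 * c)\<^sup>2 / 2"

lemma log_deriv_H_deriv:
  assumes "c > 0" "r > 0"
  shows "(log_deriv_H c has_real_derivative log_deriv2_H c r) (at r)"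
proof -
  have "r + 2 * c \<noteq> 0" "r * 2 + 4 * c \<noteq> 0" "r \<noteq> 0" using assms by auto
  then show ?thesis
    unfolding log_deriv_H_def log_deriv2_H_def
    by (auto intro!: derivative_eq_intros simp: power2_eq_square)
       (simp add: divide_simps, simp add: algebra_simps)
qed

lemma radial_chain:
  fixes p w :: "real ^ 4"
  assumes "(f has_real_derivative d) (at (p $ 1))"
  shows "((\<lambda>t. f ((p + t *\<^sub>R w) $ 1)) has_real_derivative d * w $ 1) (at 0)"
proof -
  have "((\<lambda>t. p $ 1 + t * w $ 1) has_real_derivative w $ 1) (at 0)"
    by (auto intro!: derivative_eq_intros)
  then show ?thesis
    using DERIV_chain2[of f d "\<lambda>t. p $ 1 + t * w $ 1" 0 "w $ 1"] assms by simp
qed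

lemma nth_line_deriv:
  fixes p w :: "real ^ 'n"
  shows "((\<lambda>t. (p + t *\<^sub>R w) $ i) has_real_derivative w $ i) (at 0)"
  by (auto intro!: derivative_eq_intros)

section \<open>The Levi-Civita connection\<close>

lemma hyper_metric_eq:
  assumes "c > 0" "p $ 1 > 0"
  shows "hyper_metric c p u v = coeff_H c (p $ 1) *
     (ratio_EH c (p $ 1) * (u $ 1 * v $ 1) + ratio_NH c (p $ 1) * (hyper_form p u * hyper_form p v)
       + u $ 3 * v $ 3 + u $ 4 * v $ 4)"
proof -
  have "p $ 1 + c \<noteq> 0" "p $ 1 + 2 * c \<noteq> 0" "p $ 1 \<noteq> 0" using assms by auto
  then show ?thesis
    unfolding hyper_metric_def coeff_H_def ratio_EH_def ratio_NH_def Let_def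
    by (simp add: divide_simps power2_eq_square) (simp add: algebra_simps)
qed

lemma hyper_metric_pos:
  assumes "c > 0" "p $ 1 > 0" "v \<noteq> 0"
  shows "hyper_metric c p v v > 0"
proof -
  have H: "coeff_H c (p $ 1) > 0" and m: "ratio_NH c (p $ 1) > 0" and q: "ratio_EH c (p $ 1) > 0"
    using assms by (auto simp: coeff_H_def ratio_NH_def ratio_EH_def intro!: divide_pos_pos)
  have nonneg: "ratio_EH c (p $ 1) * (v $ 1 * v $ 1) \<ge> 0"
    "ratio_NH c (p $ 1) * (hyper_form p v * hyper_form p v) \<ge> 0"
    "v $ 3 * v $ 3 \<ge> 0" "v $ 4 * v $ 4 \<ge> 0"
    using m q by simp_all
  have "ratio_EH c (p $ 1) * (v $ 1 * v $ 1) + ratio_NH c (p $ 1) * (hyper_form p v * hyper_form p v)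
       + v $ 3 * v $ 3 + v $ 4 * v $ 4 \<noteq> 0"
  proof
    assume "ratio_EH c (p $ 1) * (v $ 1 * v $ 1) + ratio_NH c (p $ 1) * (hyper_form p v * hyper_form p v)
       + v $ 3 * v $ 3 + v $ 4 * v $ 4 = 0"
    with nonneg have "ratio_EH c (p $ 1) * (v $ 1 * v $ 1) = 0"
      "ratio_NH c (p $ 1) * (hyper_form p v * hyper_form p v) = 0"
      "v $ 3 * v $ 3 = 0" "v $ 4 * v $ 4 = 0"
      by linarith+
    then have "v $ 1 = 0" "v $ 3 = 0" "v $ 4 = 0" "hyper_form p v = 0" using m q by auto
    then have "v = 0" by (intro vec4_eqI) (auto simp: hyper_form_def)
    with assms show False by simp
  qed
  with nonneg have "ratio_EH c (p $ 1) * (v $ 1 * v $ 1) + ratio_NH c (p $ 1) * (hyper_form p v * hyper_form p v)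
       + v $ 3 * v $ 3 + v $ 4 * v $ 4 > 0"
    by linarith
  with H show ?thesis by (simp add: hyper_metric_eq assms)
qed

lemma hyper_metric_sym: "hyper_metric c p u v = hyper_metric c p v u"
  by (simp only: hyper_metric_def Let_def mult.commute)

lemma hyper_metric_linear: "linear (hyper_metric c p u)"
  unfolding hyper_metric_def Let_def
  by (intro linear_compose_add linear_mult_const linear_nth hyper_form_linear)

text \<open>The derivative of the metric at \<open>p\<close> in direction \<open>w\<close>, for constant vectors \<open>u\<close>, \<open>v\<close>.\<close>

definition hyper_dmetric :: "real \<Rightarrow> real ^ 4 \<Rightarrow> real ^ 4 \<Rightarrow> real ^ 4 \<Rightarrow> real ^ 4 \<Rightarrow> real" where
  "hyper_dmetric c p w u v =
    (let r = p $ 1; a = hyper_form p u; b = hyper_form p v;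
         \<alpha> = log_deriv_E c r; n = log_deriv_N c r; h = log_deriv_H c r
     in coeff_H c r *
          (2 * w $ 1 * (\<alpha> * ratio_EH c r * (u $ 1 * v $ 1) + n * ratio_NH c r * (a * b)
              + h * (u $ 3 * v $ 3 + u $ 4 * v $ 4))
           + ratio_NH c r * (base_area w u * b + a * base_area w v)))"

lemma hyper_metric_deriv:
  assumes "c > 0" "p $ 1 > 0"
  shows "((\<lambda>t. hyper_metric c (p + t *\<^sub>R w) u v) has_real_derivative hyper_dmetric c p w u v) (at 0)"
proof -
  have ev: "eventually (\<lambda>t. hyper_metric c (p + t *\<^sub>R w) u v =
      coeff_H c ((p + t *\<^sub>R w) $ 1) *
     (ratio_EH c ((p + t *\<^sub>R w) $ 1) * (u $ 1 * v $ 1)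
       + ratio_NH c ((p + t *\<^sub>R w) $ 1) * (hyper_form (p + t *\<^sub>R w) u * hyper_form (p + t *\<^sub>R w) v)
       + u $ 3 * v $ 3 + u $ 4 * v $ 4)) (nhds 0)"
  proof -
    have "((\<lambda>t. p $ 1 + t * w $ 1) \<longlongrightarrow> p $ 1 + 0 * w $ 1) (nhds 0)"
      by (intro tendsto_add tendsto_mult tendsto_const filterlim_ident)
    then have "eventually (\<lambda>t. p $ 1 + t * w $ 1 > 0) (nhds 0)"
      using order_tendstoD(1)[of _ "p $ 1" "nhds 0" 0] assms by simp
    then show ?thesis
      by eventually_elim (rule hyper_metric_eq, use assms in simp_all)
  qed
  have "((\<lambda>t. coeff_H c ((p + t *\<^sub>R w) $ 1) *
     (ratio_EH c ((p + t *\<^sub>R w) $ 1) * (u $ 1 * v $ 1)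
       + ratio_NH c ((p + t *\<^sub>R w) $ 1) * (hyper_form (p + t *\<^sub>R w) u * hyper_form (p + t *\<^sub>R w) v)
       + u $ 3 * v $ 3 + u $ 4 * v $ 4)) has_real_derivative hyper_dmetric c p w u v) (at 0)"
    unfolding hyper_dmetric_def Let_def
    by (rule derivative_eq_intros hyper_form_has_derivative assms refl
        radial_chain[OF coeff_H_deriv] radial_chain[OF ratio_EH_deriv] radial_chain[OF ratio_NH_deriv])+
       (simp only: scaleR_zero_left add_0_right, algebra)
  then show ?thesis
    using DERIV_cong_ev[OF refl ev refl] by blast
qed

text \<open>
  The connection is read off from the geodesics, the extremals of
  \<open>(E r'\<^sup>2 + N a\<^sup>2 + H (x'\<^sup>2 + y'\<^sup>2)) / 2\<close> with \<open>a = \<eta>\<close> of the velocity. The second coordinate is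
  cyclic, so \<open>N a\<close> is conserved; this gives the term \<open>n\<close> in the second component, whose
  remaining terms convert \<open>\<eta>\<close> back to the coordinate. The two terms with \<open>m\<close> are the
  magnetic force of the field \<open>d\<eta>\<close> on a particle of charge \<open>N a\<close> in the \<open>xy\<close>-plane.
\<close>

definition hyper_conn :: "real \<Rightarrow> real ^ 4 \<Rightarrow> real ^ 4 \<Rightarrow> real ^ 4 \<Rightarrow> real ^ 4" where
  "hyper_conn c p u v =
    (let r = p $ 1; a = hyper_form p u; b = hyper_form p v;
         \<alpha> = log_deriv_E c r; n = log_deriv_N c r; h = log_deriv_H c r;
         m = ratio_NH c r; q = ratio_HE c r;
         \<Gamma>3 = h * (u $ 1 * v $ 3 + u $ 3 * v $ 1) - m * (a * v $ 4 + b * u $ 4);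
         \<Gamma>4 = h * (u $ 1 * v $ 4 + u $ 4 * v $ 1) + m * (a * v $ 3 + b * u $ 3)
     in vec4 (\<alpha> * (u $ 1 * v $ 1) - q * n * m * (a * b) - q * h * (u $ 3 * v $ 3 + u $ 4 * v $ 4))
             (n * (u $ 1 * b + v $ 1 * a) - p $ 3 * \<Gamma>4 + p $ 4 * \<Gamma>3) \<Gamma>3 \<Gamma>4)"

lemma hyper_conn_nth:
  fixes c p u v
  defines "r \<equiv> p $ 1" and "a \<equiv> hyper_form p u" and "b \<equiv> hyper_form p v"
  defines "\<alpha> \<equiv> log_deriv_E c r" and "n \<equiv> log_deriv_N c r" and "h \<equiv> log_deriv_H c r"
    and "m \<equiv> ratio_NH c r" and "q \<equiv> ratio_HE c r"
  shows "hyper_conn c p u v $ 1 =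
      \<alpha> * (u $ 1 * v $ 1) - q * n * m * (a * b) - q * h * (u $ 3 * v $ 3 + u $ 4 * v $ 4)"
    and "hyper_conn c p u v $ 3 = h * (u $ 1 * v $ 3 + u $ 3 * v $ 1) - m * (a * v $ 4 + b * u $ 4)"
    and "hyper_conn c p u v $ 4 = h * (u $ 1 * v $ 4 + u $ 4 * v $ 1) + m * (a * v $ 3 + b * u $ 3)"
    and "hyper_form p (hyper_conn c p u v) = n * (u $ 1 * b + v $ 1 * a)"
    and "hyper_conn c p u v $ 2 = n * (u $ 1 * b + v $ 1 * a)
           - p $ 3 * hyper_conn c p u v $ 4 + p $ 4 * hyper_conn c p u v $ 3"
  by (simp_all add: hyper_conn_def Let_def assms hyper_form_def[of p "vec4 _ _ _ _"])

lemma hyper_conn_linear: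
  "linear (hyper_conn c p u)" "linear (\<lambda>u. hyper_conn c p u v)"
  by (intro linearI vec4_eqI;
      simp add: hyper_conn_nth linear_add[OF hyper_form_linear] linear_scale[OF hyper_form_linear];
      simp add: algebra_simps)+

text \<open>
  The Koszul formula for constant vector fields. With \<open>(H/E) (E/H) = 1\<close> it is an identity of
  polynomials in the components and the coefficient functions.
\<close>

lemma hyper_koszul:
  assumes "c > 0" "p $ 1 > 0"
  shows "hyper_dmetric c p u v w + hyper_dmetric c p v u w - hyper_dmetric c p w u v
    = 2 * hyper_metric c p (hyper_conn c p u v) w"
  unfolding hyper_dmetric_def Let_def hyper_metric_eq[OF assms] hyper_conn_nth(1-4) base_area_def
  using ratio_HE_EH[OF assms] by algebra

lemma hyper_christoffel:
  assumes "c > 0" "p \<in> hyper_M"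
  shows "christoffel (hyper_metric c) k i j p = hyper_conn c p (axis i 1) (axis j 1) $ k"
proof (rule christoffel_koszul)
  have p: "p $ 1 > 0" using assms by (simp add: hyper_M_def)
  have pd: "partial_deriv i (\<lambda>x. metric_matrix (hyper_metric c) x $ j $ l) p
     = hyper_dmetric c p (axis i 1) (axis j 1) (axis l 1)" for i j l
    unfolding partial_deriv_def metric_matrix_def
    using hyper_metric_deriv[OF assms(1) p, THEN DERIV_imp_deriv] by simp
  show "partial_deriv i (\<lambda>x. metric_matrix (hyper_metric c) x $ j $ l) p
      + partial_deriv j (\<lambda>x. metric_matrix (hyper_metric c) x $ i $ l) p
      - partial_deriv l (\<lambda>x. metric_matrix (hyper_metric c) x $ i $ j) p
      = 2 * hyper_metric c p (hyper_conn c p (axis i 1) (axis j 1)) (axis l 1)" for l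
    unfolding pd by (rule hyper_koszul[OF assms(1) p])
  show "linear (hyper_metric c p u)" for u by (rule hyper_metric_linear)
  show "hyper_metric c p u v = hyper_metric c p v u" for u v by (rule hyper_metric_sym)
  show "hyper_metric c p v v > 0" if "v \<noteq> 0" for v by (rule hyper_metric_pos[OF assms(1) p that])
qed

section \<open>The curvature tensor\<close>

text \<open>The derivative of the connection at \<open>p\<close> in direction \<open>w\<close>, for constant vectors \<open>u\<close>, \<open>v\<close>.\<close>

definition hyper_dconn :: "real \<Rightarrow> real ^ 4 \<Rightarrow> real ^ 4 \<Rightarrow> real ^ 4 \<Rightarrow> real ^ 4 \<Rightarrow> real ^ 4" where
  "hyper_dconn c p w u v =
    (let r = p $ 1; a = hyper_form p u; b = hyper_form p v;
         a' = base_area w u; b' = base_area w v;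
         \<alpha> = log_deriv_E c r; n = log_deriv_N c r; h = log_deriv_H c r;
         m = ratio_NH c r; q = ratio_HE c r;
         \<alpha>' = log_deriv2_E c r * w $ 1; n' = log_deriv2_N c r * w $ 1; h' = log_deriv2_H c r * w $ 1;
         m' = 2 * (n - h) * m * w $ 1; q' = 2 * (h - \<alpha>) * q * w $ 1;
         D3 = h' * (u $ 1 * v $ 3 + u $ 3 * v $ 1) - m' * (a * v $ 4 + b * u $ 4)
              - m * (a' * v $ 4 + b' * u $ 4);
         D4 = h' * (u $ 1 * v $ 4 + u $ 4 * v $ 1) + m' * (a * v $ 3 + b * u $ 3)
              + m * (a' * v $ 3 + b' * u $ 3)
     in vec4 (\<alpha>' * (u $ 1 * v $ 1) - (q' * n * m + q * n' * m + q * n * m') * (a * b)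
                - q * n * m * (a' * b + a * b') - (q' * h + q * h') * (u $ 3 * v $ 3 + u $ 4 * v $ 4))
             (n' * (u $ 1 * b + v $ 1 * a) + n * (u $ 1 * b' + v $ 1 * a')
                - w $ 3 * hyper_conn c p u v $ 4 - p $ 3 * D4
                + w $ 4 * hyper_conn c p u v $ 3 + p $ 4 * D3) D3 D4)"

lemma hyper_conn_deriv:
  assumes "c > 0" "p $ 1 > 0"
  shows "((\<lambda>t. hyper_conn c (p + t *\<^sub>R w) u v $ l) has_real_derivative hyper_dconn c p w u v $ l) (at 0)"
proof -
  note rules = derivative_eq_intros hyper_form_has_derivative nth_line_deriv
        radial_chain[OF log_deriv_E_deriv] radial_chain[OF log_deriv_N_deriv] radial_chain[OF log_deriv_H_deriv]
        radial_chain[OF ratio_HE_deriv] radial_chain[OF ratio_NH_deriv]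
  have 1: "((\<lambda>t. hyper_conn c (p + t *\<^sub>R w) u v $ 1) has_real_derivative hyper_dconn c p w u v $ 1) (at 0)"
    unfolding hyper_conn_nth
    by (rule rules assms refl)+
       (simp only: scaleR_zero_left add_0_right hyper_dconn_def Let_def vec4_nth, algebra)
  have 3: "((\<lambda>t. hyper_conn c (p + t *\<^sub>R w) u v $ 3) has_real_derivative hyper_dconn c p w u v $ 3) (at 0)"
    unfolding hyper_conn_nth
    by (rule rules assms refl)+
       (simp only: scaleR_zero_left add_0_right hyper_dconn_def Let_def vec4_nth, algebra)
  have 4: "((\<lambda>t. hyper_conn c (p + t *\<^sub>R w) u v $ 4) has_real_derivative hyper_dconn c p w u v $ 4) (at 0)"
    unfolding hyper_conn_nth
    by (rule rules assms refl)+
       (simp only: scaleR_zero_left add_0_right hyper_dconn_def Let_def vec4_nth, algebra)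
  have 2: "((\<lambda>t. hyper_conn c (p + t *\<^sub>R w) u v $ 2) has_real_derivative hyper_dconn c p w u v $ 2) (at 0)"
    unfolding hyper_conn_nth(5)
    by (rule 3 4 rules assms refl)+
       (simp only: scaleR_zero_left add_0_right hyper_dconn_def Let_def vec4_nth, algebra)
  show ?thesis using 1 2 3 4 exhaust_4[of l] by auto
qed

lemma hyper_dconn_linear:
  "linear (\<lambda>w. hyper_dconn c p w u v)" "linear (\<lambda>u. hyper_dconn c p w u v)" "linear (hyper_dconn c p w u)"
  unfolding hyper_dconn_def Let_def
  by (intro linear_vec4 linear_compose_add linear_compose_sub linear_mult_const linear_nth
      hyper_form_linear base_area_linear
      linear_compose[OF hyper_conn_linear(1) linear_nth, unfolded o_def]
      linear_compose[OF hyper_conn_linear(2) linear_nth, unfolded o_def])+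

lemma open_hyper_M: "open hyper_M"
  unfolding hyper_M_def by (intro open_Collect_less continuous_intros)

lemma hyper_riemann:
  assumes "c > 0" "p \<in> hyper_M"
  shows "riemann (hyper_metric c) p u v w = hyper_dconn c p u v w - hyper_dconn c p v u w
     + hyper_conn c p u (hyper_conn c p v w) - hyper_conn c p v (hyper_conn c p u w)"
  by (rule riemann_connection_form[OF open_hyper_M assms(2)])
     (use assms in \<open>auto intro: hyper_christoffel hyper_conn_linear hyper_dconn_linear hyper_conn_deriv
        simp: hyper_M_def\<close>)

lemma hyper_form_dconn:
  fixes c p w u v
  defines "r \<equiv> p $ 1" and "a \<equiv> hyper_form p u" and "b \<equiv> hyper_form p v"
  shows "hyper_form p (hyper_dconn c p w u v) =
     log_deriv2_N c r * w $ 1 * (u $ 1 * b + v $ 1 * a)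
     + log_deriv_N c r * (u $ 1 * base_area w v + v $ 1 * base_area w u)
     - w $ 3 * hyper_conn c p u v $ 4 + w $ 4 * hyper_conn c p u v $ 3"
  unfolding assms hyper_form_def[of p "hyper_dconn _ _ _ _ _"]
  by (simp add: hyper_dconn_def Let_def)

lemma hyper_dconn_nth:
  fixes c p w u v
  defines "r \<equiv> p $ 1" and "a \<equiv> hyper_form p u" and "b \<equiv> hyper_form p v"
    and "a' \<equiv> base_area w u" and "b' \<equiv> base_area w v"
  defines "\<alpha> \<equiv> log_deriv_E c r" and "n \<equiv> log_deriv_N c r" and "h \<equiv> log_deriv_H c r"
    and "m \<equiv> ratio_NH c r" and "q \<equiv> ratio_HE c r"
    and "\<alpha>' \<equiv> log_deriv2_E c r * w $ 1" and "n' \<equiv> log_deriv2_N c r * w $ 1"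
    and "h' \<equiv> log_deriv2_H c r * w $ 1"
  shows "hyper_dconn c p w u v $ 1 =
      \<alpha>' * (u $ 1 * v $ 1)
        - (2 * (h - \<alpha>) * q * w $ 1 * n * m + q * n' * m + q * n * (2 * (n - h) * m * w $ 1)) * (a * b)
        - q * n * m * (a' * b + a * b')
        - (2 * (h - \<alpha>) * q * w $ 1 * h + q * h') * (u $ 3 * v $ 3 + u $ 4 * v $ 4)"
    and "hyper_dconn c p w u v $ 3 =
      h' * (u $ 1 * v $ 3 + u $ 3 * v $ 1) - 2 * (n - h) * m * w $ 1 * (a * v $ 4 + b * u $ 4)
        - m * (a' * v $ 4 + b' * u $ 4)"
    and "hyper_dconn c p w u v $ 4 =
      h' * (u $ 1 * v $ 4 + u $ 4 * v $ 1) + 2 * (n - h) * m * w $ 1 * (a * v $ 3 + b * u $ 3)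
        + m * (a' * v $ 3 + b' * u $ 3)"
  by (simp_all only: hyper_dconn_def Let_def vec4_nth assms)

text \<open>
  The quadratic form of the curvature in the components \<open>p\<^sub>i\<^sub>j\<close> of the bivector \<open>u \<and> v\<close> with respect
  to the coframe \<open>dr, \<eta>, dx, dy\<close>. The coefficients of the squares are, up to normalisation, the
  sectional curvatures of the coordinate planes of this coframe. The mixed term collects all three
  products of complementary components, since the decomposability relation
  \<open>p\<^sub>0\<^sub>1 p\<^sub>2\<^sub>3 = p\<^sub>0\<^sub>2 p\<^sub>1\<^sub>3 - p\<^sub>0\<^sub>3 p\<^sub>1\<^sub>2\<close> expresses two of them by the first.
\<close>

lemma hyper_curvature_frame:
  fixes c p u v
  assumes c: "c > 0" and p: "p \<in> hyper_M"
  defines "r \<equiv> p $ 1" and "a \<equiv> hyper_form p u" and "b \<equiv> hyper_form p v"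
  defines "\<alpha> \<equiv> log_deriv_E c r" and "n \<equiv> log_deriv_N c r" and "h \<equiv> log_deriv_H c r"
    and "m \<equiv> ratio_NH c r" and "q \<equiv> ratio_HE c r"
    and "n' \<equiv> log_deriv2_N c r" and "h' \<equiv> log_deriv2_H c r"
  defines "p01 \<equiv> u $ 1 * b - v $ 1 * a" and "p23 \<equiv> base_area u v"
    and "p02 \<equiv> u $ 1 * v $ 3 - v $ 1 * u $ 3" and "p03 \<equiv> u $ 1 * v $ 4 - v $ 1 * u $ 4"
    and "p12 \<equiv> a * v $ 3 - b * u $ 3" and "p13 \<equiv> a * v $ 4 - b * u $ 4"
  shows "hyper_metric c p (riemann (hyper_metric c) p u v v) u =
    coeff_H c r * (- m * (n' + n\<^sup>2 - \<alpha> * n) * p01\<^sup>2 - (h' + h\<^sup>2 - \<alpha> * h) * (p02\<^sup>2 + p03\<^sup>2)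
      + m * (m - q * n * h) * (p12\<^sup>2 + p13\<^sup>2) - (h\<^sup>2 * q + 3 * m) * p23\<^sup>2
      - 6 * m * (n - h) * (p01 * p23))"
proof -
  have r: "p $ 1 > 0" using p by (simp add: hyper_M_def)
  let ?R = "riemann (hyper_metric c) p u v v"
  define X where "X =
    - m * (n' + n\<^sup>2 - \<alpha> * n) * b * p01 - (h' + h\<^sup>2 - \<alpha> * h) * (v $ 3 * p02 + v $ 4 * p03)
      - m * (n - h) * (2 * b * p23 + v $ 3 * p13 - v $ 4 * p12)"
  have form: "hyper_form p ?R = hyper_form p (hyper_dconn c p u v v) - hyper_form p (hyper_dconn c p v u v)
     + hyper_form p (hyper_conn c p u (hyper_conn c p v v)) - hyper_form p (hyper_conn c p v (hyper_conn c p u v))"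
    unfolding hyper_riemann[OF c p]
    by (simp only: linear_add[OF hyper_form_linear] linear_diff[OF hyper_form_linear])
  \<comment> \<open>The radial component carries a factor \<open>H/E\<close>; splitting it off first lets \<open>E/H\<close> cancel it.\<close>
  have R1: "?R $ 1 = q * X"
    unfolding X_def assms hyper_riemann[OF c p] vector_add_component vector_minus_component
      hyper_dconn_nth hyper_conn_nth(1-4) base_area_def
    by algebra
  have "ratio_EH c r * ?R $ 1 = X"
    using ratio_HE_EH[OF c r, folded r_def q_def] R1 by algebra
  then have E: "ratio_EH c r * (?R $ 1 * u $ 1) = X * u $ 1"
    by (simp only: mult.assoc[symmetric])
  have F: "hyper_form p ?R = (n' + n\<^sup>2 - \<alpha> * n) * v $ 1 * p01 + (m - q * n * h) * (v $ 3 * p12 + v $ 4 * p13)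
    + (n - h) * (2 * v $ 1 * p23 + v $ 3 * p03 - v $ 4 * p02)"
    unfolding assms form hyper_form_dconn
      hyper_dconn_nth hyper_conn_nth(1-4) base_area_def
    by algebra
  show ?thesis
    unfolding hyper_metric_eq[OF c r] E[unfolded r_def] F X_def assms
    unfolding hyper_riemann[OF c p] vector_add_component vector_minus_component
      hyper_dconn_nth hyper_conn_nth(1-4) base_area_def
    by algebra
qed

section \<open>The curvature as a combination of two quadratic forms\<close>

text \<open>
  The two-form \<open>\<theta>\<^sub>0 \<and> \<theta>\<^sub>1 - \<theta>\<^sub>2 \<and> \<theta>\<^sub>3\<close> of the orthonormal coframe proportional to
  \<open>dr, \<eta>, dx, dy\<close>. Its first coefficient is \<open>\<surd>(E N) = 1 / (4 r\<^sup>2)\<close>. The minus sign selects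
  the half of the two-forms on which the Weyl curvature lives.
\<close>

definition hyper_omega :: "real \<Rightarrow> real ^ 4 \<Rightarrow> real ^ 4 \<Rightarrow> real ^ 4 \<Rightarrow> real" where
  "hyper_omega c p u v = (u $ 1 * hyper_form p v - v $ 1 * hyper_form p u) / (4 * (p $ 1)\<^sup>2)
     - coeff_H c (p $ 1) * base_area u v"

lemma hyper_omega_change_of_basis:
  "hyper_omega c p (a *\<^sub>R u + b *\<^sub>R v) (d *\<^sub>R u + e *\<^sub>R v) = (a * e - b * d) * hyper_omega c p u v"
  unfolding hyper_omega_def base_area_def linear_add[OF hyper_form_linear] linear_scale[OF hyper_form_linear]
    vector_add_component vector_scaleR_component divide_inverse real_scaleR_def by algebra

text \<open>Lagrange's identity in the coframe \<open>dr, \<eta>, dx, dy\<close>.\<close>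

lemma hyper_gram:
  fixes c p u v
  assumes "c > 0" "p $ 1 > 0"
  defines "r \<equiv> p $ 1" and "a \<equiv> hyper_form p u" and "b \<equiv> hyper_form p v"
  defines "m \<equiv> ratio_NH c r" and "i \<equiv> ratio_EH c r"
  shows "gram (hyper_metric c p) u v = (coeff_H c r)\<^sup>2 *
     (i * m * (u $ 1 * b - v $ 1 * a)\<^sup>2
      + i * ((u $ 1 * v $ 3 - v $ 1 * u $ 3)\<^sup>2 + (u $ 1 * v $ 4 - v $ 1 * u $ 4)\<^sup>2)
      + m * ((a * v $ 3 - b * u $ 3)\<^sup>2 + (a * v $ 4 - b * u $ 4)\<^sup>2)
      + (base_area u v)\<^sup>2)"
  unfolding gram_def hyper_metric_eq[OF assms(1,2)] base_area_def assms by algebra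

text \<open>The curvature parameter \<open>t\<close>, as a function of the scale-invariant coordinate \<open>s = r / c\<close>.\<close>

definition cube_ratio :: "real \<Rightarrow> real" where
  "cube_ratio s = (s / (s + 2)) ^ 3"

text \<open>
  The reciprocals \<open>A\<close>, \<open>S\<close>, \<open>W\<close> of \<open>r\<close>, \<open>r + c\<close>, \<open>r + 2c\<close> satisfy a single relation, which
  says that \<open>r + c\<close> is the mean of the other two. It turns all rational identities in
  \<open>r\<close> and \<open>c\<close> into polynomial identities modulo one quadric.
\<close>

lemma coeff_reciprocals:
  fixes c r
  assumes "c > 0" "r > 0"
  defines "A \<equiv> 1 / r" and "S \<equiv> 1 / (r + c)" and "W \<equiv> 1 / (r + 2 * c)"
  shows "A > 0" "S > 0" "W > 0" "A * S + S * W = 2 * A * W"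
    and "log_deriv_E c r = (W - S) / 2 - A" "log_deriv_N c r = (S - W) / 2 - A"
      "log_deriv_H c r = W / 2 - A"
    and "log_deriv2_N c r = (W\<^sup>2 - S\<^sup>2) / 2 + A\<^sup>2" "log_deriv2_H c r = A\<^sup>2 - W\<^sup>2 / 2"
    and "coeff_H c r = A\<^sup>2 / (2 * W)" "ratio_NH c r = W\<^sup>2 / (2 * S)"
      "ratio_HE c r = 2 / S" "ratio_EH c r = S / 2"
    and "cube_ratio (r / c) = (W / A) ^ 3" "1 / (4 * r\<^sup>2) = A\<^sup>2 / 4"
proof -
  show "A > 0" "S > 0" "W > 0" using assms by simp_all
  have nz: "r \<noteq> 0" "r + c \<noteq> 0" "r + 2 * c \<noteq> 0" using assms by simp_all
  show "A * S + S * W = 2 * A * W"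
    using nz unfolding A_def S_def W_def by (simp add: divide_simps)
  show "log_deriv_E c r = (W - S) / 2 - A" "log_deriv_N c r = (S - W) / 2 - A"
    by (simp_all add: log_deriv_E_def log_deriv_N_def A_def S_def W_def)
  show "log_deriv_H c r = W / 2 - A"
    by (simp add: log_deriv_H_def A_def W_def)
  show "log_deriv2_N c r = (W\<^sup>2 - S\<^sup>2) / 2 + A\<^sup>2" "log_deriv2_H c r = A\<^sup>2 - W\<^sup>2 / 2"
    by (simp_all add: log_deriv2_N_def log_deriv2_H_def A_def S_def W_def power_divide)
  show "coeff_H c r = A\<^sup>2 / (2 * W)" "ratio_NH c r = W\<^sup>2 / (2 * S)" "ratio_HE c r = 2 / S" "ratio_EH c r = S / 2"
    by (simp_all add: coeff_H_def ratio_NH_def ratio_HE_def ratio_EH_def A_def S_def W_def power_divide)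
  have "r / c / (r / c + 2) = W / A"
    using assms(1,2) by (simp add: A_def W_def field_simps)
  then show "cube_ratio (r / c) = (W / A) ^ 3" by (simp add: cube_ratio_def)
  show "1 / (4 * r\<^sup>2) = A\<^sup>2 / 4" by (simp add: A_def power_divide)
qed

text \<open>
  This is \<open>E N = (1 / (4 r\<^sup>2))\<^sup>2\<close>: the factors \<open>r + c\<close> and \<open>r + 2c\<close> cancel in the area element of
  the \<open>dr, \<eta>\<close> planes.
\<close>

lemma coeff_volume:
  assumes "c > 0" "r > 0"
  shows "(coeff_H c r)\<^sup>2 * (ratio_EH c r * ratio_NH c r) = (1 / (4 * r\<^sup>2))\<^sup>2"
proof -
  define A S W where "A = 1 / r" and "S = 1 / (r + c)" and "W = 1 / (r + 2 * c)"
  note rec = coeff_reciprocals[OF assms, folded A_def S_def W_def]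
  show ?thesis
    unfolding rec(10,11,13,15) using rec(1-3) by (simp add: power_divide power_mult_distrib)
qed

text \<open>
  Eliminating the product \<open>p\<^sub>0\<^sub>1 p\<^sub>2\<^sub>3\<close> by the decomposability relation turns \<open>Gram - \<omega>\<^sup>2\<close>
  into a quadratic form in the other four components, which is a sum of two squares. Geometrically,
  the squares are those of the pairings of \<open>u \<and> v\<close> with the two forms that complete \<open>\<omega>\<close> to a
  basis of its half of the two-forms.
\<close>

lemma hyper_omega_le_gram:
  assumes "c > 0" "p $ 1 > 0"
  shows "(hyper_omega c p u v)\<^sup>2 \<le> gram (hyper_metric c p) u v"
proof -
  define H where "H = coeff_H c (p $ 1)"
  define i where "i = ratio_EH c (p $ 1)"
  define m where "m = ratio_NH c (p $ 1)"
  define k where "k = 1 / (4 * (p $ 1)\<^sup>2)"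
  have "i > 0" using assms by (simp add: i_def ratio_EH_def)
  have vol: "H\<^sup>2 * (i * m) = k\<^sup>2"
    using coeff_volume[OF assms] by (simp add: H_def i_def m_def k_def)
  have om: "hyper_omega c p u v = k * (u $ 1 * hyper_form p v - v $ 1 * hyper_form p u) - H * base_area u v"
    by (simp add: hyper_omega_def k_def H_def)
  let ?a = "hyper_form p u" and ?b = "hyper_form p v"
  have "i * (gram (hyper_metric c p) u v - (hyper_omega c p u v)\<^sup>2) =
     (i * H * (u $ 1 * v $ 3 - v $ 1 * u $ 3) + k * (?a * v $ 4 - ?b * u $ 4))\<^sup>2
     + (i * H * (u $ 1 * v $ 4 - v $ 1 * u $ 4) - k * (?a * v $ 3 - ?b * u $ 3))\<^sup>2"
    unfolding hyper_gram[OF assms, folded i_def m_def H_def] om base_area_def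
    using vol by algebra
  then have "i * (gram (hyper_metric c p) u v - (hyper_omega c p u v)\<^sup>2) \<ge> 0" by simp
  then show ?thesis using \<open>i > 0\<close> by (simp add: zero_le_mult_iff)
qed

text \<open>
  The special choice of the coefficients enters here: the curvatures of the planes \<open>01\<close> and
  \<open>23\<close> are both \<open>-2 - 2t\<close>, those of the other four coordinate planes are all \<open>t - 2\<close>. This
  coincidence, together with the value of the mixed term, makes the curvature a combination of the
  Gram determinant and one square.
\<close>

lemma curvature_coefficients:
  fixes c r
  assumes "c > 0" "r > 0"
  defines "\<alpha> \<equiv> log_deriv_E c r" and "n \<equiv> log_deriv_N c r" and "h \<equiv> log_deriv_H c r"
    and "m \<equiv> ratio_NH c r" and "q \<equiv> ratio_HE c r" and "i \<equiv> ratio_EH c r" and "H \<equiv> coeff_H c r"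
    and "n' \<equiv> log_deriv2_N c r" and "h' \<equiv> log_deriv2_H c r" and "t \<equiv> cube_ratio (r / c)"
  shows "n' + n\<^sup>2 - \<alpha> * n = (2 + 2 * t) * H * i"
    and "h' + h\<^sup>2 - \<alpha> * h = (2 - t) * H * i"
    and "m - q * n * h = (t - 2) * H"
    and "h\<^sup>2 * q + 3 * m = (2 + 2 * t) * H"
    and "m * (n - h) = - t * (1 / (4 * r\<^sup>2))"
proof -
  define A S W where "A = 1 / r" and "S = 1 / (r + c)" and "W = 1 / (r + 2 * c)"
  note rec = coeff_reciprocals[OF assms(1,2), folded A_def S_def W_def]
  have nz: "A \<noteq> 0" "S \<noteq> 0" "W \<noteq> 0" using rec(1-3) by simp_all
  note rel = rec(4)
  note defs = \<alpha>_def n_def h_def m_def q_def i_def H_def n'_def h'_def t_def rec(5-15)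
  \<comment> \<open>The cube in \<open>t\<close> partly cancels against \<open>H\<close>, which keeps the degrees of the identities low.\<close>
  have tH: "t * H = W\<^sup>2 / (2 * A)"
    unfolding defs using nz by (simp add: power_divide power2_eq_square power3_eq_cube)
  have h: "2 * h = W - 2 * A" and n: "2 * n = S - W - 2 * A" and \<alpha>: "2 * \<alpha> = W - S - 2 * A"
    and n': "2 * n' = W\<^sup>2 - S\<^sup>2 + 2 * A\<^sup>2" and h': "2 * h' = 2 * A\<^sup>2 - W\<^sup>2"
    by (simp_all add: defs)
  have "2 * A * W * (n' + n\<^sup>2 - \<alpha> * n) = (A ^ 3 + W ^ 3) * S"
    using rel n \<alpha> n' by algebra
  moreover have "2 * A * W * ((2 + 2 * t) * H * i) = (A ^ 3 + W ^ 3) * S"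
  proof -
    have "2 * A * W * ((2 + 2 * t) * H * i) = 4 * A * W * (H + t * H) * i" by algebra
    then show ?thesis unfolding tH using nz
      by (simp add: defs field_simps power2_eq_square power3_eq_cube)
  qed
  ultimately show "n' + n\<^sup>2 - \<alpha> * n = (2 + 2 * t) * H * i"
    using nz by (metis mult_cancel_left mult_eq_0_iff zero_neq_numeral)
  have "4 * A * W * (h' + h\<^sup>2 - \<alpha> * h) = (2 * A ^ 3 - W ^ 3) * S"
    using rel h \<alpha> h' by algebra
  moreover have "4 * A * W * ((2 - t) * H * i) = (2 * A ^ 3 - W ^ 3) * S"
  proof -
    have "4 * A * W * ((2 - t) * H * i) = 4 * A * W * (2 * H - t * H) * i" by algebra
    then show ?thesis unfolding tH using nz
      by (simp add: defs field_simps power2_eq_square power3_eq_cube)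
  qed
  ultimately show "h' + h\<^sup>2 - \<alpha> * h = (2 - t) * H * i"
    using nz by (metis mult_cancel_left mult_eq_0_iff zero_neq_numeral)
  have mS: "2 * S * m = W\<^sup>2" "S * q = 2" "2 * W * H = A\<^sup>2" "2 * A * (t * H) = W\<^sup>2"
    using nz by (simp_all add: tH) (simp_all add: defs)
  have "(2 * A * W * S) * (m - q * n * h) = A * W * (2 * S * m) - A * W / 2 * (S * q) * (2 * n) * (2 * h)" by algebra
  also have "\<dots> = S * (W * W\<^sup>2 - 2 * A * A\<^sup>2)"
    unfolding mS h n using rel by algebra
  also have "\<dots> = (2 * A * W * S) * (t * H - 2 * H)"
    unfolding mS(3,4)[symmetric] by algebra
  finally have "m - q * n * h = t * H - 2 * H" using nz by simp
  then show "m - q * n * h = (t - 2) * H" by (simp add: left_diff_distrib)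
  have "(2 * A * W * S) * (h\<^sup>2 * q + 3 * m) = A * W / 2 * (S * q) * (2 * h)\<^sup>2 + 3 * A * W * (2 * S * m)" by algebra
  also have "\<dots> = S * (2 * A * A\<^sup>2 + 2 * W * W\<^sup>2)"
    unfolding mS h n using rel by algebra
  also have "\<dots> = (2 * A * W * S) * (2 * H + 2 * (t * H))"
    unfolding mS(3,4)[symmetric] by algebra
  finally have "h\<^sup>2 * q + 3 * m = 2 * H + 2 * (t * H)" using nz by simp
  then show "h\<^sup>2 * q + 3 * m = (2 + 2 * t) * H" by (simp add: distrib_right)
  have "4 * A * S * (m * (n - h)) = W\<^sup>2 * (A * S - 2 * A * W)"
    using mS(1) h n by algebra
  also have "\<dots> = - (S * W ^ 3)" using rel by algebra
  also have "\<dots> = 4 * A * S * (- t * (1 / (4 * r\<^sup>2)))"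
    unfolding t_def rec(14,15) using nz by (simp add: power_divide power2_eq_square power3_eq_cube)
  finally have "4 * A * S * (m * (n - h)) = 4 * A * S * (- t * (1 / (4 * r\<^sup>2)))" .
  moreover have "4 * A * S \<noteq> 0" using nz by simp
  ultimately show "m * (n - h) = - t * (1 / (4 * r\<^sup>2))"
    by (metis mult_left_cancel)
qed

text \<open>
  Comparing coefficients: \<open>(t - 2) Gram\<close> accounts for the four coordinate planes of curvature
  \<open>t - 2\<close>; the squares for the planes \<open>01\<close> and \<open>23\<close> then each need a further \<open>- 3 t\<close>,
  and the mixed term has the size that completes \<open>\<omega>\<^sup>2\<close>.
\<close>

lemma hyper_curvature:
  assumes c: "c > 0" and p: "p \<in> hyper_M"
  defines "t \<equiv> cube_ratio (p $ 1 / c)"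
  shows "hyper_metric c p (riemann (hyper_metric c) p u v v) u =
    (t - 2) * gram (hyper_metric c p) u v - 3 * t * (hyper_omega c p u v)\<^sup>2"
proof -
  have r: "p $ 1 > 0" using p by (simp add: hyper_M_def)
  define H where "H = coeff_H c (p $ 1)"
  define i where "i = ratio_EH c (p $ 1)"
  define m where "m = ratio_NH c (p $ 1)"
  define k where "k = 1 / (4 * (p $ 1)\<^sup>2)"
  have vol: "H\<^sup>2 * (i * m) = k\<^sup>2"
    using coeff_volume[OF c r] by (simp add: H_def i_def m_def k_def)
  have om: "hyper_omega c p u v = k * (u $ 1 * hyper_form p v - v $ 1 * hyper_form p u) - H * base_area u v"
    by (simp add: hyper_omega_def k_def H_def)
  note coeffs = curvature_coefficients[OF c r, folded t_def H_def i_def m_def k_def]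
  have cross: "6 * m * (log_deriv_N c (p $ 1) - log_deriv_H c (p $ 1)) * x = - 6 * t * k * x" for x
    using coeffs(5) by algebra
  show ?thesis
    unfolding hyper_curvature_frame[OF c p, folded m_def H_def] coeffs(1-4) cross
      hyper_gram[OF c r, folded i_def m_def H_def] om base_area_def
    using vol by algebra
qed

section \<open>Sectional curvature and pinching\<close>

lemma sectional_of_basis_hyper:
  assumes c: "c > 0" and p: "p \<in> hyper_M" and "gram (hyper_metric c p) u v > 0"
  defines "t \<equiv> cube_ratio (p $ 1 / c)"
  shows "sectional_of_basis (hyper_metric c) p u v =
    t - 2 - 3 * t * ((hyper_omega c p u v)\<^sup>2 / gram (hyper_metric c p) u v)"
proof -
  have "sectional_of_basis (hyper_metric c) p u v =
      ((t - 2) * gram (hyper_metric c p) u v - 3 * t * (hyper_omega c p u v)\<^sup>2) / gram (hyper_metric c p) u v"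
    by (simp add: sectional_of_basis_def hyper_curvature[OF c p] t_def gram_def)
  then show ?thesis using assms(3) by (simp add: diff_divide_distrib)
qed

lemma hyper_plane_iff:
  assumes "c > 0" "p \<in> hyper_M"
  shows "span {u, v} \<in> planes \<longleftrightarrow> gram (hyper_metric c p) u v > 0"
proof (rule span_pair_plane_iff[OF hyper_metric_linear hyper_metric_sym hyper_metric_pos])
  show "c > 0" "p $ 1 > 0" using assms by (simp_all add: hyper_M_def)
qed

text \<open>
  A change of basis multiplies \<open>\<omega>\<close> by its determinant and the Gram determinant by the square of
  it, so the quotient is a function of the plane and the description in the definition of the
  sectional curvature has a unique solution.
\<close>

lemma sectional_curvature_hyper:
  assumes c: "c > 0" and p: "p \<in> hyper_M" and gram: "gram (hyper_metric c p) u v > 0"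
  defines "t \<equiv> cube_ratio (p $ 1 / c)"
  shows "sectional_curvature (hyper_metric c) p (span {u, v}) =
    t - 2 - 3 * t * ((hyper_omega c p u v)\<^sup>2 / gram (hyper_metric c p) u v)"
proof -
  let ?G = "gram (hyper_metric c p)" and ?w = "hyper_omega c p"
  have basis: "sectional_of_basis (hyper_metric c) p u' v' = t - 2 - 3 * t * ((?w u v)\<^sup>2 / ?G u v)"
    if span: "span {u', v'} = span {u, v}" for u' v'
  proof -
    have "?G u' v' > 0"
      using hyper_plane_iff[OF c p, of u' v'] hyper_plane_iff[OF c p, of u v] gram span by simp
    obtain a b where u': "u' = a *\<^sub>R u + b *\<^sub>R v"
      using span_pair_combination[of u' u v] span span_base[of u' "{u', v'}"] by auto
    obtain d e where v': "v' = d *\<^sub>R u + e *\<^sub>R v"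
      using span_pair_combination[of v' u v] span span_base[of v' "{u', v'}"] by auto
    have G: "?G u' v' = (a * e - b * d)\<^sup>2 * ?G u v"
      unfolding u' v' by (rule gram_change_of_basis[OF hyper_metric_linear hyper_metric_sym])
    have w: "?w u' v' = (a * e - b * d) * ?w u v"
      unfolding u' v' by (rule hyper_omega_change_of_basis)
    have "a * e - b * d \<noteq> 0" using G \<open>?G u' v' > 0\<close> by auto
    then have "(?w u' v')\<^sup>2 / ?G u' v' = (?w u v)\<^sup>2 / ?G u v"
      unfolding G w by (simp add: power_mult_distrib)
    then show ?thesis
      using sectional_of_basis_hyper[OF c p \<open>?G u' v' > 0\<close>] by (simp add: t_def)
  qed
  show ?thesis
    unfolding sectional_curvature_def
    using basis by (intro the_equality) auto
qed

lemma cube_ratio_bounds: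
  assumes "s > 0"
  shows "0 < cube_ratio s" "cube_ratio s < 1"
  using assms by (simp_all add: cube_ratio_def power_strict_mono[of "s / (s + 2)" 1 3, simplified])

lemma sectional_curvature_hyper_bounds:
  assumes c: "c > 0" and p: "p \<in> hyper_M" and P: "P \<in> planes"
  defines "t \<equiv> cube_ratio (p $ 1 / c)"
  shows "sectional_curvature (hyper_metric c) p P \<le> t - 2"
    and "- 2 - 2 * t \<le> sectional_curvature (hyper_metric c) p P"
proof -
  have r: "p $ 1 > 0" using p by (simp add: hyper_M_def)
  have t: "t > 0" using r c by (simp add: t_def cube_ratio_bounds)
  obtain u v where uv: "P = span {u, v}" using plane_obtains_basis[OF P] .
  let ?G = "gram (hyper_metric c p) u v"
  have G: "?G > 0" using P hyper_plane_iff[OF c p] uv by simp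
  define x where "x = (hyper_omega c p u v)\<^sup>2 / ?G"
  have x: "0 \<le> x" "x \<le> 1"
    using G hyper_omega_le_gram[OF c r, of u v] by (simp_all add: x_def)
  have K: "sectional_curvature (hyper_metric c) p P = t - 2 - 3 * t * x"
    unfolding uv t_def x_def by (rule sectional_curvature_hyper[OF c p G])
  show "sectional_curvature (hyper_metric c) p P \<le> t - 2"
    using K x t by simp
  have "t * x \<le> t * 1" using x t by (intro mult_left_mono) auto
  then show "- 2 - 2 * t \<le> sectional_curvature (hyper_metric c) p P"
    using K by simp
qed

text \<open>
  The vectors \<open>\<partial>\<^sub>r\<close> and \<open>\<partial>\<^sub>\<phi>\<close> span a plane on which \<open>\<omega>\<close> is the area form, and \<open>\<partial>\<^sub>r\<close> with
  the lift \<open>\<partial>\<^sub>x + y \<partial>\<^sub>\<phi>\<close> of \<open>\<partial>\<^sub>x\<close> to the kernel of \<open>\<eta>\<close> spans a plane on which it vanishes.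
\<close>

lemma sectional_curvature_hyper_attained:
  assumes c: "c > 0" and p: "p \<in> hyper_M"
  defines "t \<equiv> cube_ratio (p $ 1 / c)"
  obtains P Q where "P \<in> planes" "sectional_curvature (hyper_metric c) p P = t - 2"
    "Q \<in> planes" "sectional_curvature (hyper_metric c) p Q = - 2 - 2 * t"
proof -
  have r: "p $ 1 > 0" using p by (simp add: hyper_M_def)
  let ?G = "gram (hyper_metric c p)" and ?w = "hyper_omega c p"
  have pos: "coeff_H c (p $ 1) > 0" "ratio_EH c (p $ 1) > 0"
    using c r by (auto simp: coeff_H_def ratio_EH_def intro!: divide_pos_pos)
  define u where "u = vec4 1 0 0 0"
  define v where "v = vec4 0 (p $ 4) 1 0"
  define v' where "v' = vec4 0 1 0 0"
  have G: "?G u v > 0"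
    using pos unfolding hyper_gram[OF c r] by (simp add: u_def v_def hyper_form_def base_area_def)
  have w: "?w u v = 0"
    by (simp add: u_def v_def hyper_omega_def hyper_form_def base_area_def)
  have G': "?G u v' = (1 / (4 * (p $ 1)\<^sup>2))\<^sup>2"
    unfolding hyper_gram[OF c r] using coeff_volume[OF c r]
    by (simp add: u_def v'_def hyper_form_def base_area_def)
  have w': "?w u v' = 1 / (4 * (p $ 1)\<^sup>2)"
    by (simp add: u_def v'_def hyper_omega_def hyper_form_def base_area_def)
  have pos': "?G u v' > 0" using G' r by simp
  show thesis
  proof (rule that)
    show "span {u, v} \<in> planes" "span {u, v'} \<in> planes"
      using G pos' hyper_plane_iff[OF c p] by auto
    show "sectional_curvature (hyper_metric c) p (span {u, v}) = t - 2"
      using sectional_curvature_hyper[OF c p G] w by (simp add: t_def)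
    show "sectional_curvature (hyper_metric c) p (span {u, v'}) = - 2 - 2 * t"
      using sectional_curvature_hyper[OF c p pos'] w' G' r by (simp add: t_def)
  qed
qed

lemma pinching_hyper:
  assumes c: "c > 0" and p: "p \<in> hyper_M"
  defines "t \<equiv> cube_ratio (p $ 1 / c)"
  shows "pinching (hyper_metric c) p = (2 - t) / (2 + 2 * t)"
proof -
  let ?K = "sectional_curvature (hyper_metric c) p"
  obtain P Q where PQ: "P \<in> planes" "?K P = t - 2" "Q \<in> planes" "?K Q = - 2 - 2 * t"
    using sectional_curvature_hyper_attained[OF c p] unfolding t_def by blast
  note bounds = sectional_curvature_hyper_bounds[OF c p, folded t_def]
  have "(GREATEST k. k \<in> ?K ` planes) = t - 2"
    using PQ bounds by (intro Greatest_equality) (auto intro: rev_image_eqI)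
  moreover have "(LEAST k. k \<in> ?K ` planes) = - 2 - 2 * t"
    using PQ bounds by (intro Least_equality) (auto intro: rev_image_eqI)
  ultimately have "pinching (hyper_metric c) p = (t - 2) / (- 2 - 2 * t)"
    by (simp add: pinching_def)
  also have "\<dots> = (- (2 - t)) / (- (2 + 2 * t))" by simp
  finally show ?thesis by (simp only: minus_divide_divide)
qed

text \<open>
  The pinching is a function of \<open>r / c\<close> alone, so a limit along \<open>r / c\<close> is a limit of one real
  variable. Positivity of \<open>r / c\<close> keeps the points inside the manifold, outside of which the
  formula says nothing about the pinching.
\<close>

lemma pinching_hyper_tendsto:
  assumes c: "c > 0" and pos: "eventually (\<lambda>s. s > 0) F"
    and lim: "((\<lambda>s. (2 - cube_ratio s) / (2 + 2 * cube_ratio s)) \<longlongrightarrow> l) F"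
  shows "(pinching (hyper_metric c) \<longlongrightarrow> l) (filtercomap (\<lambda>p. p $ 1 / c) F)"
proof -
  have "((\<lambda>p :: real ^ 4. (2 - cube_ratio (p $ 1 / c)) / (2 + 2 * cube_ratio (p $ 1 / c))) \<longlongrightarrow> l)
          (filtercomap (\<lambda>p. p $ 1 / c) F)"
    by (rule filterlim_compose[OF lim filterlim_filtercomap])
  moreover have "eventually (\<lambda>p :: real ^ 4. pinching (hyper_metric c) p =
      (2 - cube_ratio (p $ 1 / c)) / (2 + 2 * cube_ratio (p $ 1 / c))) (filtercomap (\<lambda>p. p $ 1 / c) F)"
    using eventually_filtercomapI[OF pos, of "\<lambda>p :: real ^ 4. p $ 1 / c"]
  proof eventually_elim
    case (elim p)
    then have "p \<in> hyper_M" using c by (simp add: hyper_M_def zero_less_divide_iff)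
    then show ?case by (rule pinching_hyper[OF c])
  qed
  ultimately show ?thesis by (subst filterlim_cong[OF refl refl])
qed

theorem theorem3:
  fixes c :: real
  assumes "c > 0"
  shows "(\<forall>p\<in>hyper_M.
            (\<exists>P\<in>planes. \<forall>Q\<in>planes.
               sectional_curvature (hyper_metric c) p Q \<le> sectional_curvature (hyper_metric c) p P) \<and>
            (\<exists>P\<in>planes. \<forall>Q\<in>planes.
               sectional_curvature (hyper_metric c) p P \<le> sectional_curvature (hyper_metric c) p Q) \<and>
            1 / 4 < pinching (hyper_metric c) p \<and> pinching (hyper_metric c) p < 1) \<and>
         (pinching (hyper_metric c) \<longlongrightarrow> 1) (filtercomap (\<lambda>p. p $ 1 / c) (at_right 0)) \<and>
         (pinching (hyper_metric c) \<longlongrightarrow> 1 / 4) (filtercomap (\<lambda>p. p $ 1 / c) at_top)"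
proof (intro conjI ballI)
  fix p assume p: "p \<in> hyper_M"
  define t where "t = cube_ratio (p $ 1 / c)"
  have t: "0 < t" "t < 1"
    using p assms by (simp_all add: t_def hyper_M_def cube_ratio_bounds)
  obtain P Q where PQ: "P \<in> planes" "sectional_curvature (hyper_metric c) p P = t - 2"
      "Q \<in> planes" "sectional_curvature (hyper_metric c) p Q = - 2 - 2 * t"
    using sectional_curvature_hyper_attained[OF assms p] unfolding t_def by blast
  note bounds = sectional_curvature_hyper_bounds[OF assms p, folded t_def]
  show "\<exists>P\<in>planes. \<forall>Q\<in>planes.
      sectional_curvature (hyper_metric c) p Q \<le> sectional_curvature (hyper_metric c) p P"
    using PQ(1,2) bounds(1) by (intro bexI[of _ P]) auto
  show "\<exists>P\<in>planes. \<forall>Q\<in>planes.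
      sectional_curvature (hyper_metric c) p P \<le> sectional_curvature (hyper_metric c) p Q"
    using PQ(3,4) bounds(2) by (intro bexI[of _ Q]) auto
  have "pinching (hyper_metric c) p = (2 - t) / (2 + 2 * t)"
    unfolding t_def by (rule pinching_hyper[OF assms p])
  moreover have "1 / 4 < (2 - t) / (2 + 2 * t)" "(2 - t) / (2 + 2 * t) < 1"
    using t by (simp_all add: field_simps)
  ultimately show "1 / 4 < pinching (hyper_metric c) p" "pinching (hyper_metric c) p < 1"
    by simp_all
next
  show "(pinching (hyper_metric c) \<longlongrightarrow> 1) (filtercomap (\<lambda>p. p $ 1 / c) (at_right 0))"
    by (rule pinching_hyper_tendsto[OF assms eventually_at_right_less])
       (unfold cube_ratio_def, real_asymp)
  show "(pinching (hyper_metric c) \<longlongrightarrow> 1 / 4) (filtercomap (\<lambda>p. p $ 1 / c) at_top)"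
    by (rule pinching_hyper_tendsto[OF assms eventually_gt_at_top])
       (unfold cube_ratio_def, real_asymp)
qed

end
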